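(* Let $G$ be a finite simple graph with $n$ vertices and $m$ edges and let $\alpha$ be a magnetic potential on $G$. Suppose that $G$ contains a Hamiltonian cycle $C_n$ (a cycle subgraph containing every vertex of $G$), and let $\alpha'$ be the restriction of $\alpha$ to the (arcs of the) cycle $C_n$. Then $(C_n,\alpha')\preccurlyeq (G,\alpha)\stackrel{m-n}{\preccurlyeq}(C_n,\alpha')$, that is, $$\lambda_k(\Delta_{\alpha'}^{C_n})\le\lambda_k(\Delta_\alpha^G)\quad\text{for all } 1\le k\le n,$$ and $$\lambda_k(\Delta_\alpha^G)\le\lambda_{k+m-n}(\Delta_{\alpha'}^{C_n})\quad\text{for all } 1\le k\le n-(m-n).$$
   Context: For a finite simple graph $G=(V,E)$ let $A$ be its set of arcs: each edge gives two oppositely oriented arcs $e,\bar e$; an arc $e$ has initial vertex $\partial_-e$ and terminal vertex $\partial_+e$; $A_v=\{e\in A : \partial_-e=v\}$ and $\deg(v)=|A_v|$. A magnetic potential on $G$ is a map $\alpha\colon A\to\mathbb{R}/2\pi\mathbb{Z}$ with $\alpha_{\bar e}=-\alpha_e$ for all $e\in A$. The discrete magnetic Laplacian is the operator $\Delta_\alpha^G$ on $\mathbb{C}^{V}$ (with its standard inner product) given by $(\Delta_\alpha^G\varphi)(v)=\deg(v)\varphi(v)-\sum_{e\in A_v}\mathrm{e}^{\mathrm{i}\alpha_e}\varphi(\partial_+e)$; it is self-adjoint and positive semidefinite. Its eigenvalues are written in ascending order, repeated according to multiplicity: $\lambda_1(\Delta_\alpha^G)\le\dots\le\lambda_n(\Delta_\alpha^G)$,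 $n=|V|$. For graphs $G,G'$ of the same order $n$ with magnetic potentials $\alpha,\alpha'$, one writes $(G,\alpha)\stackrel{r}{\preccurlyeq}(G',\alpha')$ if $\lambda_k(\Delta_\alpha^G)\le\lambda_{k+r}(\Delta_{\alpha'}^{G'})$ for all $1\le k\le n-r$, and $\preccurlyeq$ for $\stackrel{0}{\preccurlyeq}$. *)

theory Defs
  imports
    "HOL-Analysis.Analysis"
    "HOL-Library.Real_Mod"
    "Graph_Theory.Digraph_Component"
    "Graph_Theory.Arc_Walk"
begin

text \<open>
  A finite simple graph is a term satisfying \<^const>\<open>graph\<close>: a finite, symmetric, loop-free digraph
  without parallel arcs, so that each edge consists of two opposite arcs.
\<close>

definition opposite_arcs :: "('v, 'a) pre_digraph \<Rightarrow> 'a \<Rightarrow> 'a \<Rightarrow> bool" where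
  "opposite_arcs G e e' \<longleftrightarrow> e \<in> arcs G \<and> e' \<in> arcs G \<and> tail G e' = head G e \<and> head G e' = tail G e"

definition edges :: "('v, 'a) pre_digraph \<Rightarrow> 'v set set" where
  "edges G = (\<lambda>e. {tail G e, head G e}) ` arcs G"

text \<open>
  A potential with values in the reals modulo \<open>2\<pi>\<close> is given by real representatives; all that is
  required of them, and all that is used below, depends only on their classes modulo \<open>2\<pi>\<close>.
\<close>

definition magnetic_potential :: "('v, 'a) pre_digraph \<Rightarrow> ('a \<Rightarrow> real) \<Rightarrow> bool" where
  "magnetic_potential G \<alpha> \<longleftrightarrow> (\<forall>e e'. opposite_arcs G e e' \<longrightarrow> [\<alpha> e' = - \<alpha> e] (rmod 2 * pi))"

text \<open>
  The operator acts on the space of complex functions on the vertex type, so it is the Laplacian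
  of \<open>G\<close> when \<open>verts G = UNIV\<close>. Recall that \<open>cis t\<close> is the exponential of \<open>\<i>t\<close>.
\<close>

definition magnetic_laplacian ::
    "('v::finite, 'a) pre_digraph \<Rightarrow> ('a \<Rightarrow> real) \<Rightarrow> complex ^ 'v \<Rightarrow> complex ^ 'v" where
  "magnetic_laplacian G \<alpha> \<phi> =
     (\<chi> v. of_nat (out_degree G v) * \<phi> $ v - (\<Sum>e\<in>out_arcs G v. cis (\<alpha> e) * \<phi> $ head G e))"

definition eigenspace :: "(complex ^ 'v \<Rightarrow> complex ^ 'v::finite) \<Rightarrow> real \<Rightarrow> (complex ^ 'v) set" where
  "eigenspace T x = {\<phi>. T \<phi> = complex_of_real x *s \<phi>}"

text \<open>
  The real eigenvalues in ascending order, repeated according to their multiplicity, which is the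
  complex dimension \<^const>\<open>vec.dim\<close> of the eigenspace. For a self-adjoint operator these are all the
  eigenvalues, and geometric and algebraic multiplicities agree.
\<close>

definition eigenvalue_list :: "(complex ^ 'v \<Rightarrow> complex ^ 'v::finite) \<Rightarrow> real list" where
  "eigenvalue_list T = (THE xs. sorted xs \<and> (\<forall>x. count_list xs x = vec.dim (eigenspace T x)))"

text \<open>The \<open>k\<close>-th eigenvalue, counted from \<open>k = 1\<close>.\<close>

definition eigenval :: "nat \<Rightarrow> (complex ^ 'v \<Rightarrow> complex ^ 'v::finite) \<Rightarrow> real" where
  "eigenval k T = eigenvalue_list T ! (k - 1)"

definition spectral_le ::
    "nat \<Rightarrow> ('v::finite, 'a) pre_digraph \<Rightarrow> ('a \<Rightarrow> real) \<Rightarrow>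
       ('w::finite, 'b) pre_digraph \<Rightarrow> ('b \<Rightarrow> real) \<Rightarrow> bool" where
  "spectral_le r G \<alpha> G' \<alpha>' \<longleftrightarrow>
     card (verts G) = card (verts G') \<and>
     (\<forall>k. 1 \<le> k \<and> k \<le> card (verts G) - r \<longrightarrow>
        eigenval k (magnetic_laplacian G \<alpha>) \<le> eigenval (k + r) (magnetic_laplacian G' \<alpha>'))"

text \<open>
  The length bound excludes the closed walk \<open>a, b, a\<close>, which is a \<^const>\<open>pre_digraph.cycle\<close> in a
  symmetric digraph.
\<close>

definition cycle_graph :: "('v, 'a) pre_digraph \<Rightarrow> bool" where
  "cycle_graph C \<longleftrightarrow> graph C \<and>
     (\<exists>p. pre_digraph.cycle C p \<and> 3 \<le> length p \<and>
        verts C = tail C ` set p \<and> arcs_ends C = symcl (arc_to_ends C ` set p))"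

definition hamiltonian_cycle :: "('v, 'a) pre_digraph \<Rightarrow> ('v, 'a) pre_digraph \<Rightarrow> bool" where
  "hamiltonian_cycle C G \<longleftrightarrow> cycle_graph C \<and> spanning C G"

end

theory Submission
  imports Defs
begin

text \<open>
  With \<open>d\<^sub>e \<phi> = \<phi>(\<partial>\<^sub>- e) - exp (\<i> \<alpha>\<^sub>e) \<phi>(\<partial>\<^sub>+ e)\<close>, the quadratic form of the magnetic Laplacian is half the
  sum of \<open>\<bar>d\<^sub>e \<phi>\<bar>\<^sup>2\<close> over the arcs. So the form of \<open>C\<close> is at most that of \<open>G\<close>, with equality on the
  common kernel of \<open>d\<^sub>e\<close> for one arc \<open>e\<close> of each of the \<open>m - n\<close> edges outside \<open>C\<close>. If the form of
  \<open>T\<close> is at most that of \<open>T'\<close> on the common kernel of \<open>r\<close> linear functionals, then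
  \<open>\<lambda>\<^sub>k T \<le> \<lambda>\<^sub>k\<^sub>+\<^sub>r T'\<close>: those \<open>r\<close> functionals, the at most \<open>k - 1\<close> coordinates in an eigenbasis of \<open>T\<close> to
  eigenvalues below \<open>\<lambda>\<^sub>k T\<close>, and the at most \<open>n - k - r\<close> coordinates in an eigenbasis of \<open>T'\<close> to
  eigenvalues above \<open>\<lambda>\<^sub>k\<^sub>+\<^sub>r T'\<close> are fewer than \<open>n\<close>, hence have a common nonzero zero \<open>x\<close>, and
  \<open>\<lambda>\<^sub>k T \<bar>x\<bar>\<^sup>2 \<le> \<langle>T x, x\<rangle> \<le> \<langle>T' x, x\<rangle> \<le> \<lambda>\<^sub>k\<^sub>+\<^sub>r T' \<bar>x\<bar>\<^sup>2\<close>.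
\<close>

subsection \<open>Self-adjoint operators\<close>

lemma dim_le_Suc_dim_kernel:
  fixes f :: "'a::field ^ 'n::finite \<Rightarrow> 'a"
  assumes f: "Vector_Spaces.linear (*s) (*) f" and S: "vec.subspace S"
  shows "vec.dim S \<le> Suc (vec.dim {x \<in> S. f x = 0})"
proof (cases "\<forall>x\<in>S. f x = 0")
  case True
  then have "{x \<in> S. f x = 0} = S" by blast
  then show ?thesis by simp
next
  case False
  then obtain s where s: "s \<in> S" "f s \<noteq> 0" by blast
  interpret f: Vector_Spaces.linear "(*s)" "(*)" f by (rule f)
  let ?K = "{x \<in> S. f x = 0}"
  have "S \<subseteq> vec.span (insert s ?K)"
  proof
    fix x assume x: "x \<in> S"
    \<comment> \<open>Subtracting this multiple of \<open>s\<close> moves \<open>x\<close> into the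
      kernel of \<open>f\<close>, so \<open>s\<close> and the kernel span \<open>S\<close>.\<close>
    let ?y = "x - (f x / f s) *s s"
    have "f ?y = 0" using s by (simp add: f.diff f.scale)
    then have "?y \<in> ?K"
      using s x S by (simp add: vec.subspace_diff vec.subspace_scale)
    then have "?y + (f x / f s) *s s \<in> vec.span (insert s ?K)"
      by (intro vec.span_add vec.span_scale) (auto intro: vec.span_base)
    then show "x \<in> vec.span (insert s ?K)" by simp
  qed
  then have "vec.dim S \<le> vec.dim (insert s ?K)"
    by (rule vec.dim_mono)
  also have "\<dots> \<le> Suc (vec.dim ?K)" by (simp add: vec.dim_insert)
  finally show ?thesis .
qed

lemma dim_le_dim_common_kernel:
  fixes F :: "('a::field ^ 'n::finite \<Rightarrow> 'a) set"
  assumes "finite F" "\<And>f. f \<in> F \<Longrightarrow> Vector_Spaces.linear (*s) (*) f"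
  shows "CARD('n) \<le> card F + vec.dim {x. \<forall>f\<in>F. f x = 0}"
  using assms
proof (induction F)
  case empty
  then show ?case by (simp add: card_cart_basis)
next
  case (insert f F)
  let ?S = "{x. \<forall>f\<in>F. f x = 0}"
  have "vec.subspace {x. g x = 0}" if "g \<in> F" for g
  proof -
    interpret g: Vector_Spaces.linear "(*s)" "(*)" g using insert.prems that by blast
    show ?thesis by (simp add: vec.subspace_def g.zero g.add g.scale)
  qed
  then have "vec.subspace ?S" by (simp add: vec.subspace_def)
  from dim_le_Suc_dim_kernel[OF _ this, of f] insert
  have "vec.dim ?S \<le> Suc (vec.dim {x \<in> ?S. f x = 0})" by simp
  moreover have "{x \<in> ?S. f x = 0} = {x. \<forall>f\<in>insert f F. f x = 0}" by auto
  ultimately show ?case using insert by simp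
qed

text \<open>Each functional lowers the dimension by at most one, so fewer than
  \<open>CARD('n)\<close> of them leave a common kernel of positive dimension.\<close>

lemma common_zero:
  fixes F :: "('a::field ^ 'n::finite \<Rightarrow> 'a) set"
  assumes "finite F" "\<And>f. f \<in> F \<Longrightarrow> Vector_Spaces.linear (*s) (*) f" "card F < CARD('n)"
  obtains x where "x \<noteq> 0" "\<And>f. f \<in> F \<Longrightarrow> f x = 0"
proof -
  have "0 < vec.dim {x. \<forall>f\<in>F. f x = 0}"
    using dim_le_dim_common_kernel[OF assms(1,2)] assms(3) by linarith
  then have "\<not> {x. \<forall>f\<in>F. f x = 0} \<subseteq> {0}"
    by (subst vec.dim_eq_0[symmetric]) linarith
  then show ?thesis using that by blast
qed

text \<open>A maximizer of the Rayleigh quotient on the unit sphere of \<open>S\<close> is an eigenvector.\<close>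

lemma selfadjoint_eigenvector:
  fixes T :: "'a::euclidean_space \<Rightarrow> 'a"
  assumes T: "linear T" and adj: "\<And>x y. T x \<bullet> y = x \<bullet> T y"
    and S: "subspace S" "S \<noteq> {0}" "T ` S \<subseteq> S"
  obtains c x where "x \<in> S" "x \<noteq> 0" "T x = c *\<^sub>R x"
proof -
  interpret T: linear T by fact
  let ?K = "S \<inter> sphere 0 1"
  obtain s where s: "s \<in> S" "s \<noteq> 0" using S(1,2) subspace_0 by blast
  have "compact ?K" by (intro closed_Int_compact closed_subspace S compact_sphere)
  moreover have "s /\<^sub>R norm s \<in> ?K" using s S(1) by (simp add: subspace_scale)
  moreover have "continuous_on ?K (\<lambda>x. T x \<bullet> x)"
    by (intro continuous_intros linear_continuous_on) (simp add: linear_conv_bounded_linear[symmetric] T)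
  ultimately obtain x where x: "x \<in> ?K" and max: "\<And>y. y \<in> ?K \<Longrightarrow> T y \<bullet> y \<le> T x \<bullet> x"
    using continuous_attains_sup[of ?K "\<lambda>x. T x \<bullet> x"] by blast
  define c where "c = T x \<bullet> x"
  have xx: "x \<bullet> x = 1" using x by (simp add: norm_eq_1)
  have le: "T y \<bullet> y \<le> c * (y \<bullet> y)" if "y \<in> S" for y
  proof (cases "y = 0")
    case False
    have "T (y /\<^sub>R norm y) \<bullet> (y /\<^sub>R norm y) \<le> c"
      unfolding c_def using that False S(1) by (intro max) (simp add: subspace_scale)
    then show ?thesis using False
      by (simp add: T.scaleR field_simps dot_square_norm power2_eq_square)
  qed (simp add: T.zero)
  \<comment> \<open>The residual, to be shown zero by perturbing \<open>x\<close> in its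
    direction.\<close>
  define w where "w = c *\<^sub>R x - T x"
  have wS: "w \<in> S" unfolding w_def using x S by (auto intro: subspace_diff subspace_scale)
  define q where "q = c * (w \<bullet> w) - T w \<bullet> w"
  have q: "q \<ge> 0" using le[OF wS] by (simp add: q_def)
  \<comment> \<open>The form \<open>c * (y \<bullet> y) - T y \<bullet> y\<close> is nonnegative on
    \<open>S\<close> and vanishes at \<open>x\<close>. The right-hand side is its value at
    \<open>x + t *\<^sub>R w\<close>, where self-adjointness merges the two cross terms.\<close>
  have quad: "0 \<le> 2 * t * (w \<bullet> w) + t\<^sup>2 * q" for t
  proof -
    have "x + t *\<^sub>R w \<in> S" using x wS S by (auto intro: subspace_add subspace_scale)
    from le[OF this]
    have "0 \<le> c * ((x + t *\<^sub>R w) \<bullet> (x + t *\<^sub>R w)) - (T x + t *\<^sub>R T w) \<bullet> (x + t *\<^sub>R w)"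
      by (simp add: T.add T.scaleR)
    also have "\<dots> = c * (x \<bullet> x) - T x \<bullet> x + 2 * t * (c * (x \<bullet> w) - T x \<bullet> w) + t\<^sup>2 * q"
      using adj[of w x] unfolding inner_commute[of w x] inner_commute[of w "T x"]
      by (simp add: inner_add_left inner_add_right inner_commute[of w x] q_def algebra_simps power2_eq_square)
    also have "c * (x \<bullet> w) - T x \<bullet> w = w \<bullet> w"
      using inner_diff_left[of "c *\<^sub>R x" "T x" w] by (simp flip: w_def)
    finally show ?thesis by (simp add: xx c_def)
  qed
  have "w \<bullet> w = 0"
  proof (rule ccontr)
    assume "w \<bullet> w \<noteq> 0"
    then have w: "w \<bullet> w > 0" by simp
    \<comment> \<open>At \<open>t = - u\<close> the linear term outweighs the quadratic one; the
      denominator is positive even when \<open>q = 0\<close>.\<close>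
    define u where "u = (w \<bullet> w) / (q + 1)"
    have ww: "w \<bullet> w = u * (q + 1)" and u: "u > 0"
      using q w by (simp_all add: u_def)
    have "2 * - u * (w \<bullet> w) + (- u)\<^sup>2 * q = u\<^sup>2 * (- q - 2)"
      unfolding ww by (simp add: algebra_simps power2_eq_square)
    also have "\<dots> < 0" using q u by (intro mult_pos_neg) auto
    finally show False using quad[of "- u"] by simp
  qed
  then have "T x = c *\<^sub>R x" by (simp add: w_def)
  moreover have "x \<noteq> 0" using xx by auto
  ultimately show ?thesis using that x by blast
qed

lemma scaleR_eq_complex_scale: "c *\<^sub>R (x :: complex ^ 'n) = complex_of_real c *s x"
  by (simp add: vec_eq_iff) (simp add: scaleR_conv_of_real)

text \<open>
  Self-adjointness is stated for the real inner product \<open>\<bullet>\<close>, the real part of the Hermitian one;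
  for complex-linear operators the two notions coincide.
\<close>

locale complex_selfadjoint =
  fixes T :: "complex ^ 'n::finite \<Rightarrow> complex ^ 'n"
  assumes linear: "Vector_Spaces.linear (*s) (*s) T"
    and selfadjoint: "T x \<bullet> y = x \<bullet> T y"
begin

sublocale T: Vector_Spaces.linear "(*s)" "(*s)" T
  by (rule linear)

lemma real_linear: "Real_Vector_Spaces.linear T"
  by (rule linearI) (simp_all add: T.add T.scale scaleR_eq_complex_scale)

text \<open>Self-adjointness makes the orthogonal complement of the span invariant under
  \<open>T\<close>. Were it nonzero, it would contain an eigenvector, which would be orthogonal to
  itself.\<close>

lemma span_eigenspaces: "vec.span (\<Union>c. eigenspace T c) = UNIV"
proof (rule ccontr)
  let ?W = "vec.span (\<Union>c. eigenspace T c)"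
  let ?O = "{y. \<forall>x\<in>?W. x \<bullet> y = 0}"
  assume "?W \<noteq> UNIV"
  moreover have "subspace ?W"
    by (rule subspaceI) (simp_all add: vec.span_zero vec.span_add vec.span_scale scaleR_eq_complex_scale)
  then have "span ?W = ?W" by (simp add: span_eq_iff)
  ultimately obtain a where a: "a \<noteq> 0" "\<And>x. x \<in> ?W \<Longrightarrow> a \<bullet> x = 0"
    using span_not_UNIV_orthogonal[of ?W] by metis
  have TW: "T x \<in> ?W" if "x \<in> ?W" for x
    using that
  proof (induction x rule: vec.span_induct_alt)
    case base
    then show ?case by (simp add: T.zero vec.span_zero)
  next
    case (step c x y)
    then obtain d where d: "T x = complex_of_real d *s x" by (auto simp: eigenspace_def)
    have "x \<in> ?W" using step(1) by (rule vec.span_base)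
    then show ?case using step
      by (simp add: T.add T.scale d vec.span_add vec.span_scale)
  qed
  have "subspace ?O" by (rule subspaceI) (simp_all add: inner_simps)
  moreover have "?O \<noteq> {0}" using a by (auto simp: inner_commute)
  moreover have "T ` ?O \<subseteq> ?O" using TW by (auto simp: selfadjoint[symmetric])
  ultimately obtain c x where x: "x \<in> ?O" "x \<noteq> 0" "T x = c *\<^sub>R x"
    by (rule selfadjoint_eigenvector[OF real_linear selfadjoint])
  then have "x \<in> eigenspace T c" by (simp add: eigenspace_def scaleR_eq_complex_scale)
  then have "x \<in> ?W" by (blast intro: vec.span_base)
  then have "x \<bullet> x = 0" using x(1) by blast
  then show False using x(2) by simp
qed

section \<open>Eigenbases and multiplicities\<close>

lemma eigenspaces_orthogonal:
  assumes "x \<in> eigenspace T c" "y \<in> eigenspace T d" "c \<noteq> d"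
  shows "x \<bullet> y = 0"
proof -
  have "c * (x \<bullet> y) = d * (x \<bullet> y)"
    using assms(1,2) selfadjoint[of x y] by (simp add: eigenspace_def scaleR_eq_complex_scale[symmetric])
  then show ?thesis using assms(3) by simp
qed

text \<open>Vectors with the same eigenvalue may fail to be orthogonal;
  \<open>eigenspace_decomposition\<close> groups them by eigenvalue to work with orthogonal
  components.\<close>

definition eigenbasis :: "(complex ^ 'n) set \<Rightarrow> (complex ^ 'n \<Rightarrow> real) \<Rightarrow> bool" where
  "eigenbasis B l \<longleftrightarrow> vec.independent B \<and> vec.span B = UNIV \<and> (\<forall>b\<in>B. T b = complex_of_real (l b) *s b)"

lemma eigenbasis_exists: "\<exists>B l. eigenbasis B l"
proof -
  obtain B where B: "B \<subseteq> (\<Union>c. eigenspace T c)" "vec.independent B"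
      "(\<Union>c. eigenspace T c) \<subseteq> vec.span B"
    by (rule vec.maximal_independent_subset)
  have "vec.span B = UNIV"
    using vec.span_minimal[OF B(3) vec.subspace_span] span_eigenspaces by auto
  moreover have "\<forall>b\<in>B. \<exists>c. T b = complex_of_real c *s b"
    using B(1) by (auto simp: eigenspace_def)
  ultimately show ?thesis using B(2) unfolding eigenbasis_def by metis
qed

context
  fixes B l
  assumes eigenbasis: "eigenbasis B l"
begin

lemma eigenbasis_finite: "finite B"
  and eigenbasis_independent: "vec.independent B"
  and eigenbasis_span: "vec.span B = UNIV"
  and eigenbasis_eigenvector: "b \<in> B \<Longrightarrow> T b = complex_of_real (l b) *s b"
  using eigenbasis vec.finiteI_independent unfolding eigenbasis_def by auto

lemma eigenbasis_card: "card B = CARD('n)"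
  using vec.dim_eq_card[OF _ eigenbasis_independent, of UNIV] eigenbasis_span
  by (simp add: card_cart_basis)

lemma eigenbasis_expansion: "x = (\<Sum>b\<in>B. vec.representation B x b *s b)"
  using vec.sum_representation_eq[OF eigenbasis_independent _ eigenbasis_finite order_refl, of x]
    eigenbasis_span by simp

lemma dim_eigenspace: "vec.dim (eigenspace T c) = card {b \<in> B. l b = c}"
proof (rule vec.dim_unique)
  let ?Bc = "{b \<in> B. l b = c}"
  show "?Bc \<subseteq> eigenspace T c"
    by (auto simp: eigenspace_def eigenbasis_eigenvector)
  show "vec.independent ?Bc"
    using eigenbasis_independent by (rule vec.independent_mono) auto
  show "eigenspace T c \<subseteq> vec.span ?Bc"
  proof
    fix x assume x: "x \<in> eigenspace T c"
    let ?r = "vec.representation B x"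
    \<comment> \<open>This is the expansion of T x - c x. As it vanishes, independence leaves only
      vectors with \<open>l b = c\<close> in the expansion of \<open>x\<close>.\<close>
    have "(\<Sum>b\<in>B. (?r b * (of_real (l b) - of_real c)) *s b)
        = (\<Sum>b\<in>B. ?r b *s T b) - of_real c *s (\<Sum>b\<in>B. ?r b *s b)"
      by (simp add: eigenbasis_eigenvector vec.scale_sum_right sum_subtractf[symmetric]
          vec.scale_left_diff_distrib right_diff_distrib mult.commute)
    also have "\<dots> = T (\<Sum>b\<in>B. ?r b *s b) - of_real c *s (\<Sum>b\<in>B. ?r b *s b)"
      by (simp add: T.sum T.scale)
    also have "\<dots> = 0"
      using x by (simp add: eigenbasis_expansion[symmetric] eigenspace_def)
    finally have "?r b * (of_real (l b) - of_real c) = 0" if "b \<in> B" for b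
      by (rule vec.independentD[OF eigenbasis_independent eigenbasis_finite order_refl _ that])
    then have r: "?r b = 0" if "b \<in> B" "l b \<noteq> c" for b using that by auto
    have "x = (\<Sum>b\<in>B. ?r b *s b)" by (rule eigenbasis_expansion)
    also have "\<dots> \<in> vec.span ?Bc"
    proof (rule vec.span_sum)
      fix b assume b: "b \<in> B"
      show "?r b *s b \<in> vec.span ?Bc"
      proof (cases "l b = c")
        case True
        with b have "b \<in> vec.span ?Bc" by (intro vec.span_base) simp
        then show ?thesis by (rule vec.span_scale)
      next
        case False
        with b r show ?thesis by (simp add: vec.span_zero)
      qed
    qed
    finally show "x \<in> vec.span ?Bc" .
  qed
qed simp

text \<open>The multiplicities fix the multiset of entries, and a sorted list is fixed by its
  multiset, so the \<open>THE\<close> in \<open>eigenvalue_list\<close> is well defined.\<close>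

lemma eigenvalue_list_eq:
  "eigenvalue_list T = sorted_list_of_multiset (image_mset l (mset_set B))"
  unfolding eigenvalue_list_def
proof (rule the_equality, intro conjI allI)
  let ?M = "image_mset l (mset_set B)"
  have count: "count ?M x = vec.dim (eigenspace T x)" for x
  proof -
    have "count ?M x = card {b \<in> B. l b = x}"
      by (simp add: count_image_mset' eigenbasis_finite)
       (simp add: eigenbasis_finite Collect_conj_eq Int_commute conj_commute eq_commute)
    then show ?thesis by (simp add: dim_eigenspace)
  qed
  show "sorted (sorted_list_of_multiset ?M)" by simp
  show "count_list (sorted_list_of_multiset ?M) x = vec.dim (eigenspace T x)" for x
    by (simp only: count[symmetric] count_mset[symmetric] mset_sorted_list_of_multiset)
  fix xs assume xs: "sorted xs \<and> (\<forall>x. count_list xs x = vec.dim (eigenspace T x))"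
  then have "mset xs = ?M"
    by (intro multiset_eqI) (simp only: count count_mset)
  then show "xs = sorted_list_of_multiset ?M"
    using xs by (metis sorted_list_of_multiset_mset sorted_sort_id)
qed

text \<open>The k-th eigenvalue sits at position \<open>k - 1\<close> of the list. By sortedness
  smaller entries come strictly before it and larger ones strictly after it.\<close>

lemma
  assumes k: "1 \<le> k" "k \<le> CARD('n)"
  shows card_less_eigenval: "card {b \<in> B. l b < eigenval k T} < k"
    and card_greater_eigenval: "card {b \<in> B. eigenval k T < l b} \<le> CARD('n) - k"
proof -
  let ?M = "image_mset l (mset_set B)"
  let ?xs = "eigenvalue_list T"
  have mset: "mset ?xs = ?M" and sorted: "sorted ?xs"
    by (simp_all add: eigenvalue_list_eq)
  have len: "length ?xs = CARD('n)"
    using arg_cong[OF mset, of size] by (simp add: eigenbasis_card)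
  have card: "card {b \<in> B. P (l b)} = card {i. i < length ?xs \<and> P (?xs ! i)}" for P
  proof -
    have "card {i. i < length ?xs \<and> P (?xs ! i)} = size (mset (filter P ?xs))"
      by (simp only: length_filter_conv_card size_mset)
    also have "\<dots> = size (filter_mset P ?M)" by (simp only: mset_filter mset)
    also have "\<dots> = card {b \<in> B. P (l b)}"
      by (simp add: filter_mset_image_mset eigenbasis_finite)
    finally show ?thesis by simp
  qed
  have *: "eigenval k T = ?xs ! (k - 1)" by (simp add: eigenval_def)
  have "{i. i < length ?xs \<and> ?xs ! i < eigenval k T} \<subseteq> {..<k - 1}"
    using sorted_nth_mono[OF sorted, of "k - 1"] unfolding * by (force simp: not_le[symmetric])
  then have "card {i. i < length ?xs \<and> ?xs ! i < eigenval k T} \<le> card {..<k - 1}"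
    by (intro card_mono) auto
  then show "card {b \<in> B. l b < eigenval k T} < k"
    using card[of "\<lambda>x. x < eigenval k T"] k by simp
  have "{i. i < length ?xs \<and> eigenval k T < ?xs ! i} \<subseteq> {k..<CARD('n)}"
  proof safe
    fix i assume i: "i < length ?xs" "eigenval k T < ?xs ! i"
    show "i \<in> {k..<CARD('n)}"
    proof (rule ccontr)
      assume "\<not> ?thesis"
      then have "i \<le> k - 1" "k - 1 < length ?xs" using i len k by auto
      then show False using sorted_nth_mono[OF sorted, of i "k - 1"] i(2) * by simp
    qed
  qed
  then have "card {i. i < length ?xs \<and> eigenval k T < ?xs ! i} \<le> card {k..<CARD('n)}"
    by (intro card_mono) auto
  then show "card {b \<in> B. eigenval k T < l b} \<le> CARD('n) - k"
    using card[of "\<lambda>x. eigenval k T < x"] by simp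
qed

section \<open>Bounds on the Rayleigh quotient\<close>

text \<open>Take for \<open>\<psi> c\<close> the component of \<open>x\<close> in the eigenspace of
  \<open>c\<close>; mixed terms vanish by orthogonality. The sums run only over eigenvalues with a
  nonzero coordinate, so vanishing coordinates restrict which eigenvalues occur.\<close>

lemma eigenspace_decomposition:
  obtains \<psi> :: "real \<Rightarrow> complex ^ 'n" where
    "x \<bullet> x = (\<Sum>c\<in>l ` {b \<in> B. vec.representation B x b \<noteq> 0}. \<psi> c \<bullet> \<psi> c)"
    "T x \<bullet> x = (\<Sum>c\<in>l ` {b \<in> B. vec.representation B x b \<noteq> 0}. c * (\<psi> c \<bullet> \<psi> c))"
proof -
  let ?r = "vec.representation B x"
  let ?A = "{b \<in> B. ?r b \<noteq> 0}"
  let ?F = "l ` ?A"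
  define \<psi> where "\<psi> c = (\<Sum>b\<in>{b \<in> ?A. l b = c}. ?r b *s b)" for c
  have fin: "finite ?A" using eigenbasis_finite by simp
  have "x = (\<Sum>b\<in>B. ?r b *s b)" by (rule eigenbasis_expansion)
  also have "\<dots> = (\<Sum>b\<in>?A. ?r b *s b)"
    by (rule sum.mono_neutral_right) (auto simp: eigenbasis_finite)
  also have "\<dots> = sum \<psi> ?F"
    unfolding \<psi>_def by (rule sum.image_gen[OF fin])
  finally have x: "x = sum \<psi> ?F" .
  have T\<psi>: "T (\<psi> c) = c *\<^sub>R \<psi> c" for c
    by (simp add: \<psi>_def T.sum T.scale eigenbasis_eigenvector scaleR_eq_complex_scale
        vec.scale_sum_right mult.commute)
  then have \<psi>: "\<psi> c \<in> eigenspace T c" for c by (simp add: eigenspace_def scaleR_eq_complex_scale)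
  have expand: "(\<Sum>c\<in>?F. a c *\<^sub>R \<psi> c) \<bullet> sum \<psi> ?F = (\<Sum>c\<in>?F. a c * (\<psi> c \<bullet> \<psi> c))" for a
  proof -
    have "(\<Sum>c\<in>?F. a c *\<^sub>R \<psi> c) \<bullet> sum \<psi> ?F = (\<Sum>c\<in>?F. \<Sum>d\<in>?F. a c * (\<psi> c \<bullet> \<psi> d))"
      unfolding inner_sum_left by (simp add: inner_sum_right sum_distrib_left)
    also have "\<dots> = (\<Sum>c\<in>?F. \<Sum>d\<in>?F. if d = c then a c * (\<psi> c \<bullet> \<psi> c) else 0)"
      using eigenspaces_orthogonal[OF \<psi> \<psi>] by (intro sum.cong) auto
    finally show ?thesis using fin by simp
  qed
  show ?thesis
  proof (rule that)
    show "x \<bullet> x = (\<Sum>c\<in>?F. \<psi> c \<bullet> \<psi> c)"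
      using expand[of "\<lambda>_. 1"] by (simp only: scaleR_one mult_1 x[symmetric])
    have "T x = (\<Sum>c\<in>?F. c *\<^sub>R \<psi> c)"
      using arg_cong[OF x, of T] by (simp only: T.sum T\<psi>)
    then show "T x \<bullet> x = (\<Sum>c\<in>?F. c * (\<psi> c \<bullet> \<psi> c))"
      using expand[of "\<lambda>c. c"] by (simp only: x[symmetric])
  qed
qed

text \<open>The form combines the eigenvalues occurring in \<open>x\<close> with nonnegative weights
  of sum \<open>x \<bullet> x\<close>.\<close>

lemma rayleigh_le:
  assumes "\<And>b. b \<in> B \<Longrightarrow> \<mu> < l b \<Longrightarrow> vec.representation B x b = 0"
  shows "T x \<bullet> x \<le> \<mu> * (x \<bullet> x)"
proof (rule eigenspace_decomposition[of x])
  let ?F = "l ` {b \<in> B. vec.representation B x b \<noteq> 0}"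
  fix \<psi> :: "real \<Rightarrow> complex ^ 'n"
  assume \<psi>: "x \<bullet> x = (\<Sum>c\<in>?F. \<psi> c \<bullet> \<psi> c)" "T x \<bullet> x = (\<Sum>c\<in>?F. c * (\<psi> c \<bullet> \<psi> c))"
  have "c \<le> \<mu>" if "c \<in> ?F" for c
    using assms that by (auto simp: not_less[symmetric])
  then show ?thesis
    unfolding \<psi> sum_distrib_left by (intro sum_mono mult_right_mono) auto
qed

lemma rayleigh_ge:
  assumes "\<And>b. b \<in> B \<Longrightarrow> l b < \<mu> \<Longrightarrow> vec.representation B x b = 0"
  shows "\<mu> * (x \<bullet> x) \<le> T x \<bullet> x"
proof (rule eigenspace_decomposition[of x])
  let ?F = "l ` {b \<in> B. vec.representation B x b \<noteq> 0}"
  fix \<psi> :: "real \<Rightarrow> complex ^ 'n"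
  assume \<psi>: "x \<bullet> x = (\<Sum>c\<in>?F. \<psi> c \<bullet> \<psi> c)" "T x \<bullet> x = (\<Sum>c\<in>?F. c * (\<psi> c \<bullet> \<psi> c))"
  have "\<mu> \<le> c" if "c \<in> ?F" for c
    using assms that by (auto simp: not_less[symmetric])
  then show ?thesis
    unfolding \<psi> sum_distrib_left by (intro sum_mono mult_right_mono) auto
qed

text \<open>Makes the coordinates admissible as functionals in \<open>common_zero\<close>.\<close>

lemma linear_coordinate: "Vector_Spaces.linear (*s) (*) (\<lambda>x. vec.representation B x b)"
proof -
  have "vec.representation B (x + y) b = vec.representation B x b + vec.representation B y b" for x y
    by (simp add: vec.representation_add eigenbasis_independent eigenbasis_span)
  moreover have "vec.representation B (c *s x) b = c * vec.representation B x b" for c x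
    by (simp add: vec.representation_scale eigenbasis_independent eigenbasis_span)
  ultimately show ?thesis
    by (simp add: Vector_Spaces.linear_iff vec.vector_space_axioms
        vector_space_over_itself.vector_space_axioms)
qed

end

end

section \<open>Comparison of eigenvalues from comparison of forms\<close>

lemma eigenval_le_of_form_le:
  fixes T T' :: "complex ^ 'n::finite \<Rightarrow> complex ^ 'n"
  assumes "complex_selfadjoint T" "complex_selfadjoint T'"
    and F: "finite F" "card F \<le> r" "\<And>f. f \<in> F \<Longrightarrow> Vector_Spaces.linear (*s) (*) f"
    and le: "\<And>x. (\<And>f. f \<in> F \<Longrightarrow> f x = 0) \<Longrightarrow> T x \<bullet> x \<le> T' x \<bullet> x"
    and k: "1 \<le> k" "k \<le> CARD('n) - r"
  shows "eigenval k T \<le> eigenval (k + r) T'"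
proof -
  interpret T: complex_selfadjoint T by fact
  interpret T': complex_selfadjoint T' by fact
  obtain B l where B: "T.eigenbasis B l" using T.eigenbasis_exists by blast
  obtain B' l' where B': "T'.eigenbasis B' l'" using T'.eigenbasis_exists by blast
  let ?X = "{b \<in> B. l b < eigenval k T}"
  let ?X' = "{b \<in> B'. eigenval (k + r) T' < l' b}"
  let ?E = "(\<lambda>b x. vec.representation B x b) ` ?X"
  let ?E' = "(\<lambda>b x. vec.representation B' x b) ` ?X'"
  have fin: "finite ?X" "finite ?X'"
    using T.eigenbasis_finite[OF B] T'.eigenbasis_finite[OF B'] by auto
  \<comment> \<open>As \<open>k\<close> is at least 1, the truncated difference
    \<open>CARD('n) - r\<close> is positive, hence a true one.\<close>
  have kr: "1 \<le> k + r" "k + r \<le> CARD('n)" "k \<le> CARD('n)" using k by auto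
  have "card (?E \<union> ?E' \<union> F) \<le> card ?X + card ?X' + card F"
    by (intro order_trans[OF card_Un_le] add_mono card_image_le fin order_refl)
  also have "\<dots> < CARD('n)"
    using T.card_less_eigenval[OF B k(1) kr(3)] T'.card_greater_eigenval[OF B' kr(1,2)] F(2) kr k by linarith
  finally have card: "card (?E \<union> ?E' \<union> F) < CARD('n)" .
  have lin: "Vector_Spaces.linear (*s) (*) f" if "f \<in> ?E \<union> ?E' \<union> F" for f
    using that F(3) T.linear_coordinate[OF B] T'.linear_coordinate[OF B'] by (elim UnE imageE) simp_all
  have "finite (?E \<union> ?E' \<union> F)" using fin F(1) by simp
  from common_zero[OF this lin card]
  obtain x where x: "x \<noteq> 0" and zero: "\<And>f. f \<in> ?E \<union> ?E' \<union> F \<Longrightarrow> f x = 0"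
    by blast
  have "eigenval k T * (x \<bullet> x) \<le> T x \<bullet> x"
    using zero by (intro T.rayleigh_ge[OF B]) blast
  also have "\<dots> \<le> T' x \<bullet> x" using zero by (intro le) blast
  also have "\<dots> \<le> eigenval (k + r) T' * (x \<bullet> x)"
    using zero by (intro T'.rayleigh_le[OF B']) blast
  finally show ?thesis using x by simp
qed


subsection \<open>The magnetic Laplacian\<close>

text \<open>The discrete covariant derivative along an arc, written d in the overview.\<close>

definition magnetic_difference ::
    "('v::finite, 'a) pre_digraph \<Rightarrow> ('a \<Rightarrow> real) \<Rightarrow> 'a \<Rightarrow> complex ^ 'v \<Rightarrow> complex" where
  "magnetic_difference G \<alpha> e \<phi> = \<phi> $ tail G e - cis (\<alpha> e) * \<phi> $ head G e"

lemma linear_magnetic_difference: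
  "Vector_Spaces.linear (*s) (*) (magnetic_difference G \<alpha> e)"
  by (simp add: Vector_Spaces.linear_iff vec.vector_space_axioms
      vector_space_over_itself.vector_space_axioms magnetic_difference_def algebra_simps)

lemma magnetic_laplacian_nth:
  "magnetic_laplacian G \<alpha> \<phi> $ v = (\<Sum>e\<in>out_arcs G v. magnetic_difference G \<alpha> e \<phi>)"
proof -
  have "(\<Sum>e\<in>out_arcs G v. magnetic_difference G \<alpha> e \<phi>)
      = (\<Sum>e\<in>out_arcs G v. \<phi> $ v - cis (\<alpha> e) * \<phi> $ head G e)"
    by (intro sum.cong) (auto simp: magnetic_difference_def out_arcs_def)
  then show ?thesis
    by (simp add: magnetic_laplacian_def out_degree_def sum_subtractf)
qed

lemma linear_magnetic_laplacian:
  "Vector_Spaces.linear (*s) (*s) (magnetic_laplacian G \<alpha>)"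
proof -
  have "magnetic_difference G \<alpha> e (\<phi> + \<psi>) = magnetic_difference G \<alpha> e \<phi> + magnetic_difference G \<alpha> e \<psi>"
    "magnetic_difference G \<alpha> e (c *s \<phi>) = c * magnetic_difference G \<alpha> e \<phi>" for e \<phi> \<psi> c
    by (simp_all add: magnetic_difference_def algebra_simps)
  then show ?thesis
    by (simp add: Vector_Spaces.linear_iff vec.vector_space_axioms vec_eq_iff
        magnetic_laplacian_nth sum.distrib sum_distrib_left)
qed

text \<open>Reversal conjugates the phase, so the two differences agree up to a unit factor;
  opposite arcs thus give the same kernel.\<close>

lemma magnetic_difference_opposite:
  assumes "magnetic_potential G \<alpha>" "opposite_arcs G e e'"
  shows "magnetic_difference G \<alpha> e' \<phi> = - (cis (- \<alpha> e) * magnetic_difference G \<alpha> e \<phi>)"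
proof -
  have "cis (\<alpha> e') = cis (- \<alpha> e)"
    using assms by (auto simp: magnetic_potential_def intro: cis_cong)
  then show ?thesis
    using assms(2) by (simp add: magnetic_difference_def opposite_arcs_def algebra_simps cis_mult)
qed

lemma inner_cis_mult_left: "(cis (- t) * z) \<bullet> w = z \<bullet> (cis t * w)"
  by (simp add: inner_complex_def algebra_simps)

text \<open>Summation by parts: the sum over arcs is averaged with its reindexing by arc reversal.
  The bilinear version also yields self-adjointness, its right-hand side being symmetric.\<close>

lemma magnetic_laplacian_form:
  assumes "graph G" and pot: "magnetic_potential G \<alpha>"
  shows "magnetic_laplacian G \<alpha> \<phi> \<bullet> \<psi> =
    (\<Sum>e\<in>arcs G. magnetic_difference G \<alpha> e \<phi> \<bullet> magnetic_difference G \<alpha> e \<psi>) / 2"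
proof -
  interpret graph G by fact
  let ?d = "magnetic_difference G \<alpha>"
  have "\<forall>e\<in>arcs G. \<exists>e'. opposite_arcs G e e'"
    using sym_arcs unfolding symmetric_conv opposite_arcs_def by metis
  then obtain r where r: "\<And>e. e \<in> arcs G \<Longrightarrow> opposite_arcs G e (r e)" by metis
  \<comment> \<open>Without parallel arcs, reversal is an involution and may reindex the
    sum.\<close>
  have rr: "r (r e) = e" if "e \<in> arcs G" for e
    using r[OF that] r[of "r e"] that by (intro no_multi_arcs) (auto simp: opposite_arcs_def arc_to_ends_def)
  have "magnetic_laplacian G \<alpha> \<phi> \<bullet> \<psi> = (\<Sum>v\<in>UNIV. \<Sum>e\<in>out_arcs G v. ?d e \<phi> \<bullet> \<psi> $ v)"
    by (simp add: inner_vec_def magnetic_laplacian_nth inner_sum_left)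
  also have "\<dots> = (\<Sum>v\<in>UNIV. \<Sum>e\<in>{e \<in> arcs G. tail G e = v}. ?d e \<phi> \<bullet> \<psi> $ tail G e)"
    by (simp add: out_arcs_def)
  also have "\<dots> = (\<Sum>e\<in>arcs G. ?d e \<phi> \<bullet> \<psi> $ tail G e)"
    by (rule sum.group) auto
  finally have 1: "magnetic_laplacian G \<alpha> \<phi> \<bullet> \<psi> = (\<Sum>e\<in>arcs G. ?d e \<phi> \<bullet> \<psi> $ tail G e)" .
  have "(\<Sum>e\<in>arcs G. ?d e \<phi> \<bullet> \<psi> $ tail G e) = (\<Sum>e\<in>arcs G. ?d (r e) \<phi> \<bullet> \<psi> $ tail G (r e))"
    by (rule sum.reindex_bij_witness[of _ r r]) (use r rr in \<open>auto simp: opposite_arcs_def\<close>)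
  also have "\<dots> = (\<Sum>e\<in>arcs G. - (?d e \<phi> \<bullet> (cis (\<alpha> e) * \<psi> $ head G e)))"
  proof (rule sum.cong[OF refl])
    fix e assume "e \<in> arcs G"
    from r[OF this] magnetic_difference_opposite[OF pot r[OF this], of \<phi>]
    show "?d (r e) \<phi> \<bullet> \<psi> $ tail G (r e) = - (?d e \<phi> \<bullet> (cis (\<alpha> e) * \<psi> $ head G e))"
      by (simp add: inner_cis_mult_left opposite_arcs_def)
  qed
  finally have "2 * (magnetic_laplacian G \<alpha> \<phi> \<bullet> \<psi>) =
      (\<Sum>e\<in>arcs G. ?d e \<phi> \<bullet> \<psi> $ tail G e) + (\<Sum>e\<in>arcs G. - (?d e \<phi> \<bullet> (cis (\<alpha> e) * \<psi> $ head G e)))"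
    using 1 by simp
  also have "\<dots> = (\<Sum>e\<in>arcs G. ?d e \<phi> \<bullet> ?d e \<psi>)"
    by (simp add: sum.distrib[symmetric] magnetic_difference_def[of _ _ _ \<psi>] inner_diff_right)
  finally show ?thesis by simp
qed

lemma complex_selfadjoint_magnetic_laplacian:
  assumes "graph G" "magnetic_potential G \<alpha>"
  shows "complex_selfadjoint (magnetic_laplacian G \<alpha>)"
proof (rule complex_selfadjoint.intro)
  fix x y
  show "magnetic_laplacian G \<alpha> x \<bullet> y = x \<bullet> magnetic_laplacian G \<alpha> y"
    unfolding magnetic_laplacian_form[OF assms] inner_commute[of x]
    by (simp add: inner_commute)
qed (rule linear_magnetic_laplacian)

section \<open>The number of edges of a cycle\<close>

text \<open>The closed walk passes at most \<open>length p\<close> vertices, while its arcs lie on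
  pairwise distinct edges: an edge traversed in both directions would force length at most
  2.\<close>

lemma card_edges_ge_cycle_graph:
  assumes "cycle_graph C"
  shows "card (verts C) \<le> card (edges C)"
proof -
  interpret graph C using assms by (simp add: cycle_graph_def)
  from assms obtain p u where p: "awalk u p u" "distinct (tl (awalk_verts u p))" "3 \<le> length p"
      "verts C = tail C ` set p"
    by (auto simp: cycle_graph_def cycle_def)
  let ?n = "length p"
  have ne: "p \<noteq> []" using p(3) by auto
  have cas: "cas u p u" and arcs: "set p \<subseteq> arcs C" using p(1) by (auto simp: awalk_def)
  have dist: "distinct (map (head C) p)"
    using p(2) ne by (simp add: awalk_verts_conv'[OF cas])
  \<comment> \<open>Two descriptions of the vertex sequence; comparing entries shows that each arc
    starts where the previous one ends.\<close>
  have verts: "map (tail C) p @ [head C (last p)] = tail C (hd p) # map (head C) p"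
    using awalk_verts_conv[of u p] awalk_verts_conv'[OF cas] ne by simp
  have step: "tail C (p ! (Suc i mod ?n)) = head C (p ! i)" if i: "i < ?n" for i
  proof (cases "Suc i < ?n")
    case True
    then show ?thesis
      using arg_cong[OF verts, of "\<lambda>xs. xs ! Suc i"] by (simp add: nth_append)
  next
    case False
    then have i: "?n = Suc i" using i by simp
    have "tail C (hd p) = u" using cas ne by (cases p) (auto simp: cas_simp)
    moreover have "head C (last p) = u"
      using awlast_if_cas[OF cas] ne by (simp add: awalk_verts_conv)
    ultimately show ?thesis
      using ne by (simp add: hd_conv_nth last_conv_nth i)
  qed
  let ?f = "\<lambda>i. {tail C (p ! i), head C (p ! i)}"
  have heads: "i = j" if "i < ?n" "j < ?n" "head C (p ! i) = head C (p ! j)" for i j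
    using dist that by (auto simp: distinct_conv_nth)
  \<comment> \<open>The cyclic predecessor of \<open>j\<close> ends at the tail of arc
    \<open>j\<close>, and distinct heads identify it with \<open>i\<close>.\<close>
  have successor: "j = Suc i mod ?n" if ij: "i < ?n" "j < ?n" "tail C (p ! j) = head C (p ! i)" for i j
  proof -
    obtain i' where i': "i' < ?n" "Suc i' mod ?n = j"
      using ij(2) that[of "?n - 1"] that[of "j - 1"] by (cases j) auto
    then have "head C (p ! i') = head C (p ! i)" using step[of i'] ij by simp
    then show ?thesis using heads[of i' i] i' ij by simp
  qed
  have "inj_on ?f {..<?n}"
  proof (rule inj_onI, rule ccontr)
    fix i j assume ij: "i \<in> {..<?n}" "j \<in> {..<?n}" "?f i = ?f j" "i \<noteq> j"
    then have "head C (p ! i) \<noteq> head C (p ! j)" using heads by auto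
    then have "tail C (p ! j) = head C (p ! i)" "tail C (p ! i) = head C (p ! j)"
      using ij(3) by (auto simp: doubleton_eq_iff)
    then have "j = Suc i mod ?n" "i = Suc j mod ?n" using successor ij(1,2) by auto
    \<comment> \<open>Two cyclic steps return to the start only if \<open>?n\<close> divides
      2.\<close>
    then show False using ij(1,2) p(3) by (auto simp: mod_Suc split: if_splits)
  qed
  then have "?n = card (?f ` {..<?n})" by (simp add: card_image)
  also have "\<dots> \<le> card (edges C)"
    unfolding edges_def using arcs
    by (intro card_mono finite_imageI finite_arcs) (auto intro!: imageI[of _ _ "\<lambda>e. {tail C e, head C e}"])
  finally have "?n \<le> card (edges C)" .
  moreover have "card (verts C) \<le> ?n"
    unfolding p(4) by (metis card_image_le card_length finite_set order_trans)
  ultimately show ?thesis by simp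
qed

section \<open>Comparison of a graph with its Hamiltonian cycle\<close>

theorem theorem4p1:
  fixes G C :: "('v::finite, 'a) pre_digraph" and \<alpha> \<alpha>' :: "'a \<Rightarrow> real" and n m :: nat
  assumes "graph G" and "verts G = UNIV"
    and "n = card (verts G)" and "m = card (edges G)"
    and "magnetic_potential G \<alpha>"
    and "hamiltonian_cycle C G"
    and "\<alpha>' = restrict \<alpha> (arcs C)"
  shows "spectral_le 0 C \<alpha>' G \<alpha> \<and> spectral_le (m - n) G \<alpha> C \<alpha>'"
proof -
  interpret G: graph G by fact
  have cyc: "cycle_graph C" and span: "spanning C G"
    using assms(6) by (auto simp: hamiltonian_cycle_def)
  then have "graph C" by (simp add: cycle_graph_def)
  then interpret C: graph C .
  have sub: "arcs C \<subseteq> arcs G" and tail: "tail C = tail G" and head: "head C = head G"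
    and verts: "verts C = verts G"
    using span by (auto simp: spanning_def subgraph_def compatible_def)
  \<comment> \<open>Outside \<open>arcs C\<close> the restriction is \<open>undefined\<close>, but
    only arcs of \<open>C\<close> are evaluated here and in \<open>diff\<close>.\<close>
  have pot: "magnetic_potential C \<alpha>'"
    using assms(5) sub by (auto simp: magnetic_potential_def opposite_arcs_def assms(7) tail head)
  have diff: "magnetic_difference C \<alpha>' e \<phi> = magnetic_difference G \<alpha> e \<phi>" if "e \<in> arcs C" for e \<phi>
    using that by (simp add: magnetic_difference_def assms(7) tail head)
  let ?D = "arcs G - arcs C"
  have form: "magnetic_laplacian G \<alpha> \<phi> \<bullet> \<phi> = magnetic_laplacian C \<alpha>' \<phi> \<bullet> \<phi> +
      (\<Sum>e\<in>?D. magnetic_difference G \<alpha> e \<phi> \<bullet> magnetic_difference G \<alpha> e \<phi>) / 2" for \<phi>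
    using sum.subset_diff[OF sub, of "\<lambda>e. magnetic_difference G \<alpha> e \<phi> \<bullet> magnetic_difference G \<alpha> e \<phi>"]
    by (simp add: magnetic_laplacian_form[OF assms(1,5)] magnetic_laplacian_form[OF \<open>graph C\<close> pot] diff
        add_divide_distrib)
  have sa: "complex_selfadjoint (magnetic_laplacian G \<alpha>)" "complex_selfadjoint (magnetic_laplacian C \<alpha>')"
    using complex_selfadjoint_magnetic_laplacian assms(1,5) \<open>graph C\<close> pot by blast+

  let ?edge = "\<lambda>e. {tail G e, head G e}"
  have "\<forall>d\<in>edges G - edges C. \<exists>e\<in>arcs G. ?edge e = d"
    by (auto simp: edges_def)
  \<comment> \<open>One arc per edge outside \<open>C\<close>, since counting both arcs would double
    the number of functionals.\<close>
  then obtain g where g: "\<And>d. d \<in> edges G - edges C \<Longrightarrow> g d \<in> arcs G \<and> ?edge (g d) = d" by metis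
  let ?F = "(\<lambda>d. magnetic_difference G \<alpha> (g d)) ` (edges G - edges C)"
  have fin: "finite (edges G)" "finite (edges C)" by (simp_all add: edges_def)
  have "edges C \<subseteq> edges G" using sub by (auto simp: edges_def tail head)
  then have "card (edges G - edges C) = m - card (edges C)"
    using fin assms(4) by (simp add: card_Diff_subset)
  \<comment> \<open>The truncation in \<open>m - n\<close> is harmless: \<open>n\<close> is at most
    the number of edges of \<open>C\<close>, hence at most \<open>m\<close>.\<close>
  also have "\<dots> \<le> m - n"
    using card_edges_ge_cycle_graph[OF cyc] assms(3) verts by simp
  finally have card: "card ?F \<le> m - n"
    using card_image_le[of "edges G - edges C" "\<lambda>d. magnetic_difference G \<alpha> (g d)"] fin by simp
  have zero: "magnetic_difference G \<alpha> e \<phi> = 0"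
    if F: "\<And>f. f \<in> ?F \<Longrightarrow> f \<phi> = 0" and e: "e \<in> ?D" for e \<phi>
  proof -
    \<comment> \<open>\<open>C\<close> contains both arcs of each of its edges, so an arc outside
      \<open>C\<close> on such an edge would be parallel to one of them.\<close>
    have "?edge e \<notin> edges C"
    proof
      assume "?edge e \<in> edges C"
      then obtain e1 where e1: "e1 \<in> arcs C" "?edge e = ?edge e1" by (auto simp: edges_def tail head)
      obtain e2 where e2: "e2 \<in> arcs C" "tail G e1 = head G e2" "head G e1 = tail G e2"
        using C.sym_arcs e1(1) unfolding symmetric_conv tail head by blast
      have "arc_to_ends G e = arc_to_ends G e1 \<or> arc_to_ends G e = arc_to_ends G e2"
        using e1(2) e2 by (auto simp: arc_to_ends_def doubleton_eq_iff)
      then have "e = e1 \<or> e = e2" using G.no_multi_arcs e e1 e2 sub by blast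
      then show False using e e1 e2 by blast
    qed
    then have d: "?edge e \<in> edges G - edges C" using e by (auto simp: edges_def)
    let ?e = "g (?edge e)"
    have g0: "magnetic_difference G \<alpha> ?e \<phi> = 0" using F d by blast
    \<comment> \<open>The chosen arc of the edge is \<open>e\<close> or its reversal, and either way
      its vanishing difference transfers to \<open>e\<close>.\<close>
    have "arc_to_ends G ?e = arc_to_ends G e \<or> opposite_arcs G ?e e"
      using g[OF d] e by (auto simp: arc_to_ends_def opposite_arcs_def doubleton_eq_iff)
    then show ?thesis
    proof
      assume "arc_to_ends G ?e = arc_to_ends G e"
      then have "?e = e" using G.no_multi_arcs g[OF d] e by blast
      then show ?thesis using g0 by simp
    next
      assume "opposite_arcs G ?e e"
      from magnetic_difference_opposite[OF assms(5) this] show ?thesis using g0 by simp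
    qed
  qed

  have "eigenval k (magnetic_laplacian C \<alpha>') \<le> eigenval (k + 0) (magnetic_laplacian G \<alpha>)"
    if "1 \<le> k" "k \<le> CARD('v) - 0" for k
    \<comment> \<open>With no functionals the forms compare everywhere, as the arcs outside
      \<open>C\<close> contribute a nonnegative sum.\<close>
    by (rule eigenval_le_of_form_le[OF sa(2,1), of "{}"]) (use that in \<open>simp_all add: form sum_nonneg\<close>)
  moreover have "eigenval k (magnetic_laplacian G \<alpha>) \<le> eigenval (k + (m - n)) (magnetic_laplacian C \<alpha>')"
    if "1 \<le> k" "k \<le> CARD('v) - (m - n)" for k
  proof (rule eigenval_le_of_form_le[OF sa, of ?F])
    show "magnetic_laplacian G \<alpha> \<phi> \<bullet> \<phi> \<le> magnetic_laplacian C \<alpha>' \<phi> \<bullet> \<phi>"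
      if F: "\<And>f. f \<in> ?F \<Longrightarrow> f \<phi> = 0" for \<phi>
    proof -
      have "magnetic_difference G \<alpha> e \<phi> = 0" if "e \<in> ?D" for e
        by (rule zero[OF _ that]) (rule F)
      then show ?thesis by (simp add: form)
    qed
  qed (use that fin card linear_magnetic_difference in auto)
  ultimately show ?thesis
    unfolding spectral_le_def using verts assms(2) by simp
qed

end
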